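(* Let $\Sigma$ be a finite alphabet of size $\sigma$ and let $T$ be a string of length $n$ over $\Sigma$. For any $1 \le i \le j < n$, with $d = j-i+1$, $$|\mathsf{MAW}(T[i..j+1]) \bigtriangleup \mathsf{MAW}(T[i..j])| \le \sigma_{i,j} + d + 1.$$ The upper bound is tight when $\sigma \ge 3$ and $\sigma_{i,j}+1 \le \sigma$; that is, for $\sigma \ge 3$ and any two integers $d, s$ with $1 \le s \le d$ and $s + 1 \le \sigma$, there exist a string $Z$ of length $d$ over $\Sigma$ containing exactly $s$ distinct characters and a character $\alpha \in \Sigma$ such that $$|\mathsf{MAW}(Z) \bigtriangleup \mathsf{MAW}(Z\alpha)| = s + d + 1.$$
   Context: Strings are finite sequences over a finite alphabet $\Sigma$; positions are 1-indexed and $T[i..j]$ denotes the substring of $T$ from position $i$ to position $j$. A string $w$ occurs in $S$ if it is a (contiguous) substring of $S$; the empty string occurs in every string. A non-empty string $w \in \Sigma^*$ is a minimal absent word (MAW) for $S$ if $w$ does not occur in $S$ but every proper substring of $w$ occurs in $S$ (equivalently, $w$ does not occur in $S$, while $w[2..|w|]$ and $w[1..|w|-1]$ both occur in $S$; in particular a single character of $\Sigma$ not occurring in $S$ is a MAW for $S$). $\mathsf{MAW}(S)$ is the set of all MAWs for $S$ (relative to $\Sigma$). $\bigtriangleup$ denotes symmetric difference. $\sigma_{i,j}$ is the number of distinct characters occurring in $T[i..j]$.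
   Formalization: Tightness is stated only for s ≥ 2 or s = d = 1; for s = 1 and d ≥ 2 the claim is false, since Z = a^d and the symmetric difference has size at most 3 < d + 2. *)

theory Defs
  imports Main "HOL-Library.Sublist"
begin

(* Positions are 1-based and both ends are included; the result is [] when j < i. *)
definition substr :: "'a list \<Rightarrow> nat \<Rightarrow> nat \<Rightarrow> 'a list" where
  "substr T i j = take (j + 1 - i) (drop (i - 1) T)"

definition MAW :: "'a set \<Rightarrow> 'a list \<Rightarrow> 'a list set" where
  "MAW \<Sigma> S = {w \<in> lists \<Sigma>. w \<noteq> [] \<and> \<not> sublist w S \<and>
    (\<forall>u. strict_sublist u w \<longrightarrow> sublist u S)}"

(* Hence "card" counts the elements of MAW \<Sigma> S, rather than being 0 by convention. *)
lemma finite_MAW: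
  assumes "finite \<Sigma>"
  shows "finite (MAW \<Sigma> S)"
proof (rule finite_subset)
  show "MAW \<Sigma> S \<subseteq> {w. set w \<subseteq> \<Sigma> \<and> length w \<le> length S + 1}"
  proof
    fix w assume w: "w \<in> MAW \<Sigma> S"
    then obtain a u where au: "w = a # u"
      by (cases w) (auto simp: MAW_def)
    then have "strict_sublist u w"
      by (auto simp: strict_sublist_def sublist_Cons_right)
    with w have "length u \<le> length S"
      by (auto simp: MAW_def dest: sublist_length_le)
    with w au show "w \<in> {w. set w \<subseteq> \<Sigma> \<and> length w \<le> length S + 1}"
      by (auto simp: MAW_def)
  qed
  show "finite {w. set w \<subseteq> \<Sigma> \<and> length w \<le> length S + 1}"
    using assms by (rule finite_lists_length_le)
qed

end

theory Submission
  imports Defs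
begin

text \<open>
  Let \<open>W\<close> be the shortest suffix of \<open>S\<alpha>\<close> that does not occur in \<open>S\<close>. Only \<open>W\<close> can stop
  being a MAW when \<open>\<alpha>\<close> is appended. A new MAW \<open>aub\<close> whose prefix \<open>au\<close> is absent from \<open>S\<close>
  satisfies \<open>au = W\<close>, so it is determined by \<open>b\<close>. For every other new MAW, \<open>b = \<alpha>\<close> and \<open>u\<close> is
  the longest common suffix of \<open>S\<close> and \<open>S[1..e]\<close>, where \<open>e < |S|\<close> is the end position of an
  occurrence of \<open>au\<close> in \<open>S\<close>, so it is determined by \<open>e\<close>. The bound is attained by
  \<open>Z = b\<^sub>2\<dots>b\<^sub>s a\<^sup>m\<close> with \<open>m = d - s + 1\<close> and a fresh character \<open>\<alpha>\<close>, for which distinct end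
  positions yield distinct words.
\<close>

section \<open>Words occurring after appending a character\<close>

lemma strict_sublist_tl_or_butlast:
  assumes "strict_sublist u w"
  shows "sublist u (tl w) \<or> sublist u (butlast w)"
proof -
  obtain ps ss where w: "w = ps @ u @ ss"
    using assms by (auto simp: strict_sublist_def sublist_def)
  show ?thesis
  proof (cases ps)
    case Nil
    with w assms have "ss \<noteq> []" by auto
    with w Nil have "butlast w = u @ butlast ss" by (simp add: butlast_append)
    then show ?thesis by simp
  next
    case (Cons p ps')
    then show ?thesis using w by simp
  qed
qed

text \<open>Every proper factor misses the first or the last letter, so the two longest proper
  factors decide minimality.\<close>

lemma MAW_iff:
  "w \<in> MAW \<Sigma> S \<longleftrightarrow> w \<in> lists \<Sigma> \<and> w \<noteq> [] \<and> \<not> sublist w S \<and>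
     sublist (tl w) S \<and> sublist (butlast w) S" (is "?L \<longleftrightarrow> ?R")
proof
  assume L: ?L
  then have "w \<noteq> []" by (simp add: MAW_def)
  then have "length (tl w) < length w" "length (butlast w) < length w" by simp_all
  then have "tl w \<noteq> w" "butlast w \<noteq> w" by force+
  then have "strict_sublist (tl w) w" "strict_sublist (butlast w) w"
    by (simp_all add: strict_sublist_def sublist_tl sublist_butlast)
  with L show ?R by (simp add: MAW_def)
next
  assume ?R
  then show ?L
    by (auto simp: MAW_def dest!: strict_sublist_tl_or_butlast intro: sublist_order.order_trans)
qed

lemma sublist_singleton_iff: "sublist [c] S \<longleftrightarrow> c \<in> set S"
  by (auto simp: sublist_def in_set_conv_decomp)

text \<open>An occurrence of \<open>u @ [b]\<close> either lies in \<open>S\<close> or ends at the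
  new \<open>x\<close>; without its last letter it lies in \<open>S\<close> in both cases.\<close>

lemma sublist_butlast_append_singleton:
  assumes "sublist (u @ [b]) (S @ [x])"
  shows "sublist u S"
  using assms sublist_order.order_trans[OF sublist_append_rightI[of u "[b]"]]
  by (auto simp: snoc_sublist_snoc)

lemma sublist_obtain_end:
  assumes "sublist u S"
  obtains e where "e \<le> length S" "suffix u (take e S)"
proof -
  obtain ps ss where S: "S = ps @ u @ ss"
    using assms by (auto simp: sublist_def)
  show ?thesis
    by (rule that[of "length (ps @ u)"]) (auto simp: S suffix_def)
qed

section \<open>The upper bound\<close>

text \<open>Any shorter suffix of \<open>S @ [x]\<close> is a suffix of \<open>tl w\<close>, so the
  condition on \<open>tl w\<close> alone makes \<open>w\<close> shortest.\<close>

definition shortest_absent_suffix :: "'a list \<Rightarrow> 'a \<Rightarrow> 'a list \<Rightarrow> bool" where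
  "shortest_absent_suffix S x w \<longleftrightarrow> suffix w (S @ [x]) \<and> \<not> sublist w S \<and> sublist (tl w) S"

lemma shortest_absent_suffix_unique:
  assumes "shortest_absent_suffix S x v" "shortest_absent_suffix S x w"
  shows "v = w"
proof -
  have aux: "length w \<le> length v"
    if "shortest_absent_suffix S x v" "shortest_absent_suffix S x w" for v w
  proof (rule ccontr)
    assume less: "\<not> length w \<le> length v"
    then obtain c t where w: "w = c # t" by (cases w) auto
    have "suffix v (S @ [x])" "suffix t (S @ [x])"
      using that w by (auto simp: shortest_absent_suffix_def simp del: suffix_snoc dest: suffix_ConsD)
    then have "suffix v t"
      using less w suffix_length_suffix by fastforce
    then have "sublist v S"
      using that w by (auto simp: shortest_absent_suffix_def
          intro: suffix_imp_sublist sublist_order.order_trans)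
    with that show False by (simp add: shortest_absent_suffix_def)
  qed
  have "length v = length w"
    using aux assms by (simp add: order_antisym)
  then show ?thesis
    using assms unfolding shortest_absent_suffix_def
    by (metis order_refl suffix_length_suffix suffix_order.antisym)
qed

text \<open>Tail and prefix of \<open>w\<close> still occur after the extension, so \<open>w\<close>
  is lost only by occurring itself, and then as a suffix of \<open>S @ [x]\<close>.\<close>

lemma card_MAW_removed: "card (MAW \<Sigma> S - MAW \<Sigma> (S @ [x])) \<le> 1"
proof -
  have "shortest_absent_suffix S x w" if "w \<in> MAW \<Sigma> S - MAW \<Sigma> (S @ [x])" for w
    using that by (auto simp: MAW_iff shortest_absent_suffix_def sublist_snoc)
  then have "\<And>v w. v \<in> MAW \<Sigma> S - MAW \<Sigma> (S @ [x]) \<Longrightarrow> w \<in> MAW \<Sigma> S - MAW \<Sigma> (S @ [x]) \<Longrightarrow> v = w"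
    by (blast intro: shortest_absent_suffix_unique)
  \<comment> \<open>\<open>\<Sigma>\<close> may be infinite here; \<open>card.infinite\<close>
    settles an infinite set by the default value 0.\<close>
  then show ?thesis
    by (metis card_le_Suc0_iff_eq One_nat_def card.infinite le0)
qed

lemma card_MAW_added_prefix_absent:
  "card {w \<in> MAW \<Sigma> (S @ [x]). w \<notin> MAW \<Sigma> S \<and> \<not> sublist (butlast w) S} \<le> card (set S) + 1"
    (is "card ?A \<le> _")
proof -
  \<comment> \<open>Each word of \<open>?A\<close> supplies a witness for this choice, and
    uniqueness then identifies its prefix with \<open>W\<close>.\<close>
  define W where "W = (SOME w. shortest_absent_suffix S x w)"
  have "?A \<subseteq> (\<lambda>b. W @ [b]) ` insert x (set S)"
  proof
    fix w assume w: "w \<in> ?A"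
    then have ne: "butlast w \<noteq> []" by auto
    then obtain a u b where aub: "w = a # u @ [b]"
      by (metis append_butlast_last_id append_Cons butlast.simps(1) list.exhaust)
    have ub: "sublist (u @ [b]) (S @ [x])" and au: "sublist (a # u) (S @ [x])"
      using w by (simp_all add: MAW_iff aub)
    have "shortest_absent_suffix S x (a # u)"
      using au w sublist_butlast_append_singleton[OF ub]
      by (simp add: shortest_absent_suffix_def sublist_snoc aub)
    then have "a # u = W"
      unfolding W_def by (metis someI shortest_absent_suffix_unique)
    moreover have "b \<in> insert x (set S)"
      using set_mono_sublist[OF ub] by auto
    ultimately show "w \<in> (\<lambda>b. W @ [b]) ` insert x (set S)"
      using aub by auto
  qed
  then have "card ?A \<le> card (insert x (set S))"
    by (meson surj_card_le finite_insert finite_set)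
  also have "\<dots> \<le> card (set S) + 1"
    by (simp add: card_insert_if)
  finally show ?thesis .
qed

text \<open>Read backwards, \<open>take e S\<close> and \<open>S\<close> agree on exactly
  \<open>u\<close>, and \<open>a\<close> is the letter of \<open>take e S\<close> at the first
  disagreement.\<close>

definition branches_at :: "'a list \<Rightarrow> 'a \<Rightarrow> nat \<Rightarrow> 'a list \<Rightarrow> bool" where
  "branches_at S x e w \<longleftrightarrow> (\<exists>a u. w = a # u @ [x] \<and>
     suffix (a # u) (take e S) \<and> suffix u S \<and> \<not> suffix (a # u) S)"

lemma branches_at_unique:
  assumes "branches_at S x e v" "branches_at S x e w"
  shows "v = w"
proof -
  \<comment> \<open>If \<open>t\<close> were longer than \<open>u\<close>, then \<open>a # u\<close>
    would be a suffix of \<open>t\<close> and hence of \<open>S\<close>. Used in both directions,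
    this equates the lengths.\<close>
  have aux: "length t \<le> length u"
    if "suffix (a # u) P" "\<not> suffix (a # u) S" "suffix (c # t) P" "suffix t S"
    for a c :: 'a and u t P
  proof (rule ccontr)
    assume "\<not> length t \<le> length u"
    then have "suffix (a # u) t"
      using that suffix_length_suffix[of "a # u" P t] suffix_ConsD by fastforce
    with that show False using suffix_order.order_trans by blast
  qed
  obtain a u c t where
    v: "v = a # u @ [x]" "suffix (a # u) (take e S)" "suffix u S" "\<not> suffix (a # u) S" and
    w: "w = c # t @ [x]" "suffix (c # t) (take e S)" "suffix t S" "\<not> suffix (c # t) S"
    using assms unfolding branches_at_def by blast
  have "length (a # u) = length (c # t)"
    using aux v w by (simp add: order_antisym)
  then have "a # u = c # t"
    using v(2) w(2) by (metis order_refl suffix_length_suffix suffix_order.antisym)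
  then show ?thesis using v w by simp
qed

text \<open>Such a word is new only because its tail was absent, so the tail ends at the appended
  \<open>x\<close>. End position 0 is impossible as \<open>a # u\<close> is non-empty, and
  \<open>length S\<close> because \<open>w\<close> would then occur in
  \<open>S @ [x]\<close>.\<close>

lemma card_MAW_added_prefix_present:
  "card {w \<in> MAW \<Sigma> (S @ [x]). w \<notin> MAW \<Sigma> S \<and> sublist (butlast w) S} \<le> length S - 1"
    (is "card ?B \<le> _")
proof -
  define g where "g e = (SOME w. branches_at S x e w)" for e
  have "?B \<subseteq> g ` {1..<length S}"
  proof
    fix w assume w: "w \<in> ?B"
    then have nt: "\<not> sublist (tl w) S"
      by (auto simp: MAW_iff sublist_snoc)
    then have "tl w \<noteq> []" by auto
    then obtain a u b where aub: "w = a # u @ [b]"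
      by (metis append_butlast_last_id list.collapse tl_Nil)
    have "suffix (u @ [b]) (S @ [x])"
      using w nt by (auto simp: MAW_iff aub sublist_snoc)
    then have b: "b = x" and u: "suffix u S"
      by simp_all
    have nau: "\<not> suffix (a # u) S"
    proof
      assume "suffix (a # u) S"
      then have "suffix w (S @ [x])" by (simp add: aub b suffix_def)
      then have "sublist w (S @ [x])" by (rule suffix_imp_sublist)
      with w show False by (simp add: MAW_iff)
    qed
    have "sublist (a # u) S" using w aub by simp
    then obtain e where e: "e \<le> length S" "suffix (a # u) (take e S)"
      by (rule sublist_obtain_end)
    have "e \<noteq> 0" using e by (intro notI) simp
    moreover have "e \<noteq> length S" using e nau by (intro notI) simp
    ultimately have "e \<in> {1..<length S}" using e by simp
    moreover have "branches_at S x e w"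
      using e u nau by (auto simp: branches_at_def aub b)
    then have "w = g e"
      unfolding g_def by (metis someI branches_at_unique)
    ultimately show "w \<in> g ` {1..<length S}" by blast
  qed
  then have "card ?B \<le> card {1..<length S}"
    by (meson surj_card_le finite_atLeastLessThan)
  then show ?thesis by simp
qed

lemma card_MAW_sym_diff_append_le:
  assumes "S \<noteq> []"
  shows "card (sym_diff (MAW \<Sigma> (S @ [x])) (MAW \<Sigma> S)) \<le> card (set S) + length S + 1"
proof -
  let ?A = "{w \<in> MAW \<Sigma> (S @ [x]). w \<notin> MAW \<Sigma> S \<and> \<not> sublist (butlast w) S}"
  let ?B = "{w \<in> MAW \<Sigma> (S @ [x]). w \<notin> MAW \<Sigma> S \<and> sublist (butlast w) S}"
  let ?R = "MAW \<Sigma> S - MAW \<Sigma> (S @ [x])"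
  have eq: "sym_diff (MAW \<Sigma> (S @ [x])) (MAW \<Sigma> S) = (?A \<union> ?B) \<union> ?R"
    by auto
  have "card (sym_diff (MAW \<Sigma> (S @ [x])) (MAW \<Sigma> S)) \<le> card ?A + card ?B + card ?R"
    unfolding eq using card_Un_le[of "?A \<union> ?B" ?R] card_Un_le[of ?A ?B] by linarith
  also have "\<dots> \<le> (card (set S) + 1) + (length S - 1) + 1"
    by (intro add_mono card_MAW_added_prefix_absent card_MAW_added_prefix_present card_MAW_removed)
  \<comment> \<open>Subtraction is truncated, so \<open>length S - 1 + 1\<close> equals
    \<open>length S\<close> only for non-empty \<open>S\<close>.\<close>
  also have "\<dots> = card (set S) + length S + 1"
    using assms by (cases S) auto
  finally show ?thesis .
qed

section \<open>Tightness\<close>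

lemma MAW_fresh_removed:
  assumes "\<alpha> \<in> \<Sigma>" "\<alpha> \<notin> set Z"
  shows "[\<alpha>] \<in> MAW \<Sigma> Z - MAW \<Sigma> (Z @ [\<alpha>])"
  using assms by (simp add: MAW_iff sublist_singleton_iff)

text \<open>The fresh \<alpha> occurs only at the very end, so no letter follows it. Here the
  shortest absent suffix is \<open>[\<alpha>]\<close>.\<close>

lemma MAW_fresh_first:
  assumes "\<alpha> \<in> \<Sigma>" "\<alpha> \<notin> set Z" "set Z \<subseteq> \<Sigma>" "b \<in> insert \<alpha> (set Z)"
  shows "[\<alpha>, b] \<in> MAW \<Sigma> (Z @ [\<alpha>]) - MAW \<Sigma> Z"
proof -
  have "\<not> sublist [\<alpha>, b] (Z @ [\<alpha>])"
    using assms(2) sublist_butlast_append_singleton[of "[\<alpha>]" b Z \<alpha>] set_mono_sublist by fastforce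
  moreover have "sublist [c] (Z @ [\<alpha>])" if "c \<in> insert \<alpha> (set Z)" for c
    using that by (simp add: sublist_singleton_iff)
  moreover have "\<not> sublist [\<alpha>] Z"
    using assms(2) by (simp add: sublist_singleton_iff)
  ultimately show ?thesis
    using assms by (auto simp: MAW_iff)
qed

text \<open>A word ending in the fresh \<alpha> can occur in \<open>Z @ [\<alpha>]\<close> only as a
  suffix, so everything reduces to suffixes of \<open>Z\<close>.\<close>

lemma MAW_fresh_last:
  assumes "\<alpha> \<in> \<Sigma>" "\<alpha> \<notin> set Z" "set Z \<subseteq> \<Sigma>"
    and "sublist (b # u) Z" "suffix u Z" "\<not> suffix (b # u) Z"
  shows "b # u @ [\<alpha>] \<in> MAW \<Sigma> (Z @ [\<alpha>]) - MAW \<Sigma> Z"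
proof -
  have absent: "\<not> sublist (v @ [\<alpha>]) Z" for v
    using assms(2) by (auto dest: set_mono_sublist)
  have "\<not> suffix ((b # u) @ [\<alpha>]) (Z @ [\<alpha>])"
    using assms(6) by (simp only: snoc_suffix_snoc) simp
  then have "\<not> sublist (b # u @ [\<alpha>]) (Z @ [\<alpha>])"
    using absent[of "b # u"] by (simp add: sublist_snoc)
  moreover have "sublist (u @ [\<alpha>]) (Z @ [\<alpha>])"
    using assms(5) by (simp add: sublist_snoc)
  moreover have "sublist (b # u) (Z @ [\<alpha>])"
    using assms(4) by (simp add: sublist_snoc)
  moreover have "set (b # u) \<subseteq> \<Sigma>"
    using assms(3,4) set_mono_sublist by blast
  ultimately show ?thesis
    using absent[of u] assms(1) by (auto simp: MAW_iff butlast_append)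
qed

lemma card_MAW_sym_diff_append_ge:
  assumes "finite \<Sigma>" "\<alpha> \<in> \<Sigma>" "\<alpha> \<notin> set Z" "set Z \<subseteq> \<Sigma>"
    and Z: "Z = bs @ replicate m a"
    and bs: "distinct bs" "a \<notin> set bs" and m: "0 < m" "bs = [] \<Longrightarrow> m = 1"
  shows "card (set Z) + length Z + 1 \<le> card (sym_diff (MAW \<Sigma> Z) (MAW \<Sigma> (Z @ [\<alpha>])))"
proof -
  \<comment> \<open>\<open>F\<close> holds the words with absent prefix. \<open>L\<close> and
    \<open>K\<close> come from end positions inside \<open>bs\<close> and inside the run of
    \<open>a\<close>, respectively. With \<open>[\<alpha>]\<close> the sizes add up to
    \<open>(card (set Z) + 1) + length bs + (m - 1) + 1\<close>.\<close>
  define F where "F = (\<lambda>b. [\<alpha>, b]) ` insert \<alpha> (set Z)"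
  define L where "L = (\<lambda>b. [b, \<alpha>]) ` set bs"
  define K where "K = (\<lambda>k. last bs # replicate k a @ [\<alpha>]) ` {1..<m}"
  have fin: "finite F" "finite L" "finite K"
    by (simp_all add: F_def L_def K_def)
  have notin: "b \<noteq> a \<Longrightarrow> \<not> suffix (b # replicate k a) Z" if "k < m" for b k
  proof
    assume b: "b \<noteq> a" "suffix (b # replicate k a) Z"
    then obtain ps where "Z = ps @ b # replicate k a" by (auto simp: suffix_def)
    \<comment> \<open>Index \<open>k\<close> of \<open>rev Z\<close> counts from the end of
      \<open>Z\<close>, where the last \<open>m\<close> letters are all \<open>a\<close>.\<close>
    then have "rev Z ! k = b" by (simp add: nth_append)
    moreover have "rev Z ! k = a" using that by (simp add: Z nth_append)
    ultimately show False using b by simp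
  qed
  have suf: "suffix (replicate k a) Z" if "k < m" for k
  proof -
    have "replicate m a = replicate (m - k) a @ replicate k a"
      using that by (simp flip: replicate_add)
    then show ?thesis by (simp add: Z suffix_def)
  qed
  have "F \<subseteq> sym_diff (MAW \<Sigma> Z) (MAW \<Sigma> (Z @ [\<alpha>]))"
    using MAW_fresh_first[OF assms(2-4)] unfolding F_def by blast
  moreover have "L \<subseteq> sym_diff (MAW \<Sigma> Z) (MAW \<Sigma> (Z @ [\<alpha>]))"
  proof
    fix w assume "w \<in> L"
    then obtain b where b: "b \<in> set bs" "w = b # [] @ [\<alpha>]" by (auto simp: L_def)
    then have "sublist [b] Z" by (simp add: Z sublist_singleton_iff)
    moreover have "\<not> suffix [b] Z"
      using notin[of 0 b] b bs m by auto
    ultimately show "w \<in> sym_diff (MAW \<Sigma> Z) (MAW \<Sigma> (Z @ [\<alpha>]))"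
      using MAW_fresh_last[OF assms(2-4), of b "[]"] b by auto
  qed
  moreover have "K \<subseteq> sym_diff (MAW \<Sigma> Z) (MAW \<Sigma> (Z @ [\<alpha>]))"
  proof
    fix w assume "w \<in> K"
    then obtain k where k: "1 \<le> k" "k < m" "w = last bs # replicate k a @ [\<alpha>]"
      by (auto simp: K_def)
    then have ne: "bs \<noteq> []" using m by auto
    then have "last bs \<noteq> a" using bs last_in_set by metis
    moreover have "Z = butlast bs @ (last bs # replicate k a) @ replicate (m - k) a"
      using ne k by (simp add: Z flip: replicate_add)
    then have "sublist (last bs # replicate k a) Z" unfolding sublist_def by blast
    ultimately show "w \<in> sym_diff (MAW \<Sigma> Z) (MAW \<Sigma> (Z @ [\<alpha>]))"
      using MAW_fresh_last[OF assms(2-4)] suf notin k by blast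
  qed
  moreover have "[\<alpha>] \<in> sym_diff (MAW \<Sigma> Z) (MAW \<Sigma> (Z @ [\<alpha>]))"
    using MAW_fresh_removed[OF assms(2,3)] by blast
  ultimately have "insert [\<alpha>] (F \<union> (L \<union> K)) \<subseteq> sym_diff (MAW \<Sigma> Z) (MAW \<Sigma> (Z @ [\<alpha>]))"
    by blast
  then have "card (insert [\<alpha>] (F \<union> (L \<union> K))) \<le> card (sym_diff (MAW \<Sigma> Z) (MAW \<Sigma> (Z @ [\<alpha>])))"
    using assms(1) by (intro card_mono) (auto intro: finite_MAW)
  moreover have "card (insert [\<alpha>] (F \<union> (L \<union> K))) = card (set Z) + length Z + 1"
  proof -
    have "card F = card (set Z) + 1"
      using assms(3) unfolding F_def by (subst card_image) (auto simp: inj_on_def)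
    moreover have "card L = length bs"
      using bs unfolding L_def by (subst card_image) (auto simp: inj_on_def distinct_card)
    moreover have "card K = m - 1"
      unfolding K_def by (subst card_image) (auto simp: inj_on_def dest: arg_cong[where f=length])
    moreover have "L \<inter> K = {}"
      unfolding L_def K_def by (auto dest: arg_cong[where f=length])
    moreover have "F \<inter> (L \<union> K) = {}"
    proof -
      have "\<alpha> \<notin> set bs" using assms(3) Z by auto
      \<comment> \<open>\<open>last []\<close> is unspecified, but \<open>K\<close> is empty when
        \<open>bs\<close> is, since then \<open>m = 1\<close>.\<close>
      moreover have "last bs \<noteq> \<alpha>" if "K \<noteq> {}"
      proof -
        have "bs \<noteq> []" using that m by (auto simp: K_def)
        then show ?thesis using \<open>\<alpha> \<notin> set bs\<close> last_in_set by metis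
      qed
      ultimately show ?thesis unfolding F_def L_def K_def by auto
    qed
    moreover have "[\<alpha>] \<notin> F \<union> (L \<union> K)"
      by (auto simp: F_def L_def K_def)
    ultimately show ?thesis
      using fin m by (simp add: card_Un_disjoint Z)
  qed
  ultimately show ?thesis by simp
qed

text \<open>The case \<open>s = 1\<close>, \<open>d > 1\<close> must be excluded: for a power of one
  letter, appending that letter changes two MAWs and appending a fresh one changes three, fewer than
  \<open>d + 2\<close>.\<close>

lemma MAW_sym_diff_append_tight:
  fixes \<Sigma> :: "'a set"
  assumes "finite \<Sigma>" "1 \<le> s" "s \<le> d" "s + 1 \<le> card \<Sigma>" "s = 1 \<longrightarrow> d = 1"
  shows "\<exists>Z \<in> lists \<Sigma>. \<exists>\<alpha> \<in> \<Sigma>. length Z = d \<and> card (set Z) = s \<and>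
    card (sym_diff (MAW \<Sigma> Z) (MAW \<Sigma> (Z @ [\<alpha>]))) = s + d + 1"
proof -
  obtain xs where xs: "set xs = \<Sigma>" "distinct xs"
    using finite_distinct_list[OF assms(1)] by blast
  have len: "s + 1 \<le> length xs" using xs assms(4) distinct_card by metis
  \<comment> \<open>Of \<open>s + 1\<close> distinct letters, one serves as \<alpha>, one as the
    repeated \<open>a\<close>, and \<open>s - 1\<close> form \<open>bs\<close>.\<close>
  define ys where "ys = take (s + 1) xs"
  have "length ys = Suc (Suc (s - 1))" using len assms(2) by (simp add: ys_def)
  then obtain \<alpha> a bs where ys: "ys = \<alpha> # a # bs" "length bs = s - 1"
    by (auto simp: length_Suc_conv)
  have dist: "distinct (\<alpha> # a # bs)" and sub: "set (\<alpha> # a # bs) \<subseteq> \<Sigma>"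
    using xs set_take_subset[of "s + 1" xs] by (auto simp flip: ys(1) simp: ys_def)
  define m where "m = d - s + 1"
  define Z where "Z = bs @ replicate m a"
  have "m \<noteq> 0" by (simp add: m_def)
  then have setZ: "set Z = insert a (set bs)" by (simp add: Z_def)
  have cardZ: "card (set Z) = s"
    using dist ys(2) assms(2) by (simp add: setZ distinct_card)
  have lenZ: "length Z = d" using assms(2,3) ys(2) by (simp add: Z_def m_def)
  have "card (set Z) + length Z + 1 \<le> card (sym_diff (MAW \<Sigma> Z) (MAW \<Sigma> (Z @ [\<alpha>])))"
  proof (rule card_MAW_sym_diff_append_ge[OF assms(1) _ _ _ Z_def])
    show "m = 1" if "bs = []" using that ys(2) assms by (simp add: m_def)
  qed (use dist sub in \<open>auto simp: setZ m_def\<close>)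
  moreover have "card (sym_diff (MAW \<Sigma> Z) (MAW \<Sigma> (Z @ [\<alpha>]))) \<le> card (set Z) + length Z + 1"
    using card_MAW_sym_diff_append_le[of Z \<Sigma> \<alpha>] by (simp add: Un_commute Z_def m_def)
  ultimately show ?thesis
    using cardZ lenZ sub setZ by (intro bexI[of _ Z] bexI[of _ \<alpha>]) auto
qed

section \<open>From appending a letter to extending a window of \<open>T\<close>\<close>

lemma substr_Suc:
  assumes "1 \<le> i" "i \<le> j" "j < length T"
  shows "substr T i (j + 1) = substr T i j @ [T ! j]"
proof -
  \<comment> \<open>The 1-based position \<open>j + 1\<close> has list index
    \<open>j\<close>.\<close>
  have "take (Suc (j + 1 - i)) (drop (i - 1) T) = take (j + 1 - i) (drop (i - 1) T) @ [T ! j]"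
    using assms by (subst take_Suc_conv_app_nth) auto
  moreover have "j + 1 + 1 - i = Suc (j + 1 - i)" using assms by simp
  ultimately show ?thesis by (simp add: substr_def)
qed

theorem theorem1:
  fixes \<Sigma> :: "'a set"
  assumes "finite \<Sigma>"
  shows "(\<forall>T \<in> lists \<Sigma>. \<forall>i j d. 1 \<le> i \<and> i \<le> j \<and> j < length T \<and> d = j - i + 1 \<longrightarrow>
            card (sym_diff (MAW \<Sigma> (substr T i (j + 1))) (MAW \<Sigma> (substr T i j)))
              \<le> card (set (substr T i j)) + d + 1)
       \<and> (3 \<le> card \<Sigma> \<longrightarrow>
            (\<forall>d s. 1 \<le> s \<and> s \<le> d \<and> s + 1 \<le> card \<Sigma> \<and> (s = 1 \<longrightarrow> d = 1) \<longrightarrow>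
              (\<exists>Z \<in> lists \<Sigma>. \<exists>\<alpha> \<in> \<Sigma>. length Z = d \<and> card (set Z) = s \<and>
                card (sym_diff (MAW \<Sigma> Z) (MAW \<Sigma> (Z @ [\<alpha>]))) = s + d + 1)))"
proof (intro conjI ballI allI impI)
  fix T :: "'a list" and i j d
  assume "1 \<le> i \<and> i \<le> j \<and> j < length T \<and> d = j - i + 1"
  then have ij: "1 \<le> i" "i \<le> j" "j < length T" and d: "d = j - i + 1"
    by auto
  have len: "length (substr T i j) = d"
    using ij d by (simp add: substr_def)
  then have "substr T i j \<noteq> []" using d by auto
  then show "card (sym_diff (MAW \<Sigma> (substr T i (j + 1))) (MAW \<Sigma> (substr T i j)))
      \<le> card (set (substr T i j)) + d + 1"
    using card_MAW_sym_diff_append_le[of "substr T i j" \<Sigma> "T ! j"]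
    unfolding substr_Suc[OF ij] len by simp
next
  fix d s
  assume "1 \<le> s \<and> s \<le> d \<and> s + 1 \<le> card \<Sigma> \<and> (s = 1 \<longrightarrow> d = 1)"
  then show "\<exists>Z \<in> lists \<Sigma>. \<exists>\<alpha> \<in> \<Sigma>. length Z = d \<and> card (set Z) = s \<and>
      card (sym_diff (MAW \<Sigma> Z) (MAW \<Sigma> (Z @ [\<alpha>]))) = s + d + 1"
    using MAW_sym_diff_append_tight[OF assms, of s d] by simp
qed

end
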